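(* (i) Let $n \in \mathbb{N}$, let $F$ be any field with at least $2n+1$ elements, and let $A \in \mathbb{M}_n(F)$ be a nonscalar matrix. Then there exists a diagonalisable matrix $B \in \mathbb{M}_n(F)$ such that the $F$-algebra generated by $A$ and $B$ is $\mathbb{M}_n(F)$. (ii) Let $n \in \mathbb{N}$ and let $A \in \mathbb{M}_n(\mathbb{H})$ be a non-realscalar matrix. Then there exists a diagonalisable matrix $B \in \mathbb{M}_n(\mathbb{H})$ such that the real algebra generated by $A$ and $B$ is irreducible, and hence, up to a similarity, it is $\mathbb{M}_n(\mathbb{R})$, $\mathbb{M}_n(\mathbb{C})$, or $\mathbb{M}_n(\mathbb{H})$.
   Context: $\mathbb{H}$ denotes the division ring of real quaternions, with $\mathbb{R}\subset\mathbb{C}\subset\mathbb{H}$ in the usual way. A matrix over a field $F$ is nonscalar if it is not of the form $\lambda I$, $\lambda\in F$; a matrix over $\mathbb{H}$ is non-realscalar if it is not of the form $rI$, $r\in\mathbb{R}$. A matrix over $D\in\{F,\mathbb{H}\}$ is diagonalisable if it equals $P^{-1}\Delta P$ for some invertible $P \in \mathbb{M}_n(D)$ and some diagonal $\Delta\in \mathbb{M}_n(D)$. The algebra generated by $A$ and $B$ over $F$ (resp. $\mathbb{R}$) is the smallest $F$-subspace (resp. real subspace) of the matrix ring that contains $A$ and $B$ and is closed under multiplication. A real subalgebra $\mathbb{A}$ of $\mathbb{M}_n(\mathbb{H})$ is irreducible if the only right $\mathbb{H}$-subspaces of the column space $\mathbb{H}^n$ invariant under (left multiplication by) all elements of $\mathbb{A}$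 are $\{0\}$ and $\mathbb{H}^n$. "Up to a similarity" means after replacing $\mathbb{A}$ by $P^{-1}\mathbb{A}P$ for some invertible $P\in\mathbb{M}_n(\mathbb{H})$. *)

theory Defs
  imports "HOL-Analysis.Analysis"
begin

section \<open>Quaternions\<close>

datatype quat = Quat (Re0: real) (Im1: real) (Im2: real) (Im3: real)

lemma quat_eq_iff:
  "x = y \<longleftrightarrow> Re0 x = Re0 y \<and> Im1 x = Im1 y \<and> Im2 x = Im2 y \<and> Im3 x = Im3 y"
  by (auto intro: quat.expand)

instantiation quat :: real_algebra_1
begin

definition zero_quat :: quat where "0 = Quat 0 0 0 0"

definition one_quat :: quat where "1 = Quat 1 0 0 0"

definition plus_quat :: "quat \<Rightarrow> quat \<Rightarrow> quat" where
  "x + y = Quat (Re0 x + Re0 y) (Im1 x + Im1 y) (Im2 x + Im2 y) (Im3 x + Im3 y)"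

definition uminus_quat :: "quat \<Rightarrow> quat" where
  "- x = Quat (- Re0 x) (- Im1 x) (- Im2 x) (- Im3 x)"

definition minus_quat :: "quat \<Rightarrow> quat \<Rightarrow> quat" where
  "x - y = Quat (Re0 x - Re0 y) (Im1 x - Im1 y) (Im2 x - Im2 y) (Im3 x - Im3 y)"

definition times_quat :: "quat \<Rightarrow> quat \<Rightarrow> quat" where
  "x * y = Quat
    (Re0 x * Re0 y - Im1 x * Im1 y - Im2 x * Im2 y - Im3 x * Im3 y)
    (Re0 x * Im1 y + Im1 x * Re0 y + Im2 x * Im3 y - Im3 x * Im2 y)
    (Re0 x * Im2 y - Im1 x * Im3 y + Im2 x * Re0 y + Im3 x * Im1 y)
    (Re0 x * Im3 y + Im1 x * Im2 y - Im2 x * Im1 y + Im3 x * Re0 y)"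

definition scaleR_quat :: "real \<Rightarrow> quat \<Rightarrow> quat" where
  "r *\<^sub>R x = Quat (r * Re0 x) (r * Im1 x) (r * Im2 x) (r * Im3 x)"

lemmas quat_defs = zero_quat_def one_quat_def plus_quat_def uminus_quat_def
  minus_quat_def times_quat_def scaleR_quat_def

instance
  by standard (auto simp: quat_defs quat_eq_iff algebra_simps)

end

definition cnj_quat :: "quat \<Rightarrow> quat" where
  "cnj_quat x = Quat (Re0 x) (- Im1 x) (- Im2 x) (- Im3 x)"

definition norm_sq_quat :: "quat \<Rightarrow> real" where
  "norm_sq_quat x = (Re0 x)\<^sup>2 + (Im1 x)\<^sup>2 + (Im2 x)\<^sup>2 + (Im3 x)\<^sup>2"

lemma norm_sq_quat_eq_0_iff: "norm_sq_quat x = 0 \<longleftrightarrow> x = 0"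
  by (auto simp: norm_sq_quat_def quat_defs quat_eq_iff add_nonneg_eq_0_iff)

lemma quat_mult_cnj: "x * cnj_quat x = norm_sq_quat x *\<^sub>R 1" "cnj_quat x * x = norm_sq_quat x *\<^sub>R 1"
  by (auto simp: norm_sq_quat_def cnj_quat_def quat_defs power2_eq_square algebra_simps)

instantiation quat :: real_div_algebra
begin

definition inverse_quat :: "quat \<Rightarrow> quat" where
  "inverse x = (1 / norm_sq_quat x) *\<^sub>R cnj_quat x"

definition divide_quat :: "quat \<Rightarrow> quat \<Rightarrow> quat" where
  "x div y = x * inverse y" for x y :: quat

instance
proof
  fix x y :: quat
  show "x \<noteq> 0 \<Longrightarrow> inverse x * x = 1" "x \<noteq> 0 \<Longrightarrow> x * inverse x = 1"
    by (simp_all add: inverse_quat_def quat_mult_cnj norm_sq_quat_eq_0_iff)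
  show "x div y = x * inverse y" by (rule divide_quat_def)
  show "inverse (0 :: quat) = 0"
    by (simp add: inverse_quat_def norm_sq_quat_eq_0_iff)
qed

end

text \<open>The subset \<open>\<real>\<close> of \<^typ>\<open>quat\<close> is the library's \<^const>\<open>Reals\<close>;
  the subfield of complex numbers is spanned by \<open>1\<close> and the first imaginary unit.\<close>

definition quat_Complexes :: "quat set" where
  "quat_Complexes = {q. Im2 q = 0 \<and> Im3 q = 0}"

section \<open>Matrices\<close>

definition diagonal_matrix :: "'d::semiring_1^'n^'n \<Rightarrow> bool" where
  "diagonal_matrix D \<longleftrightarrow> (\<forall>i j. i \<noteq> j \<longrightarrow> D $ i $ j = 0)"

definition diagonalisable :: "'d::semiring_1^'n^'n \<Rightarrow> bool" where
  "diagonalisable B \<longleftrightarrow>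
    (\<exists>(P :: 'd^'n^'n) (D :: 'd^'n^'n). invertible P \<and> diagonal_matrix D \<and> B = matrix_inv P ** D ** P)"

definition matrix_smult :: "'a::semiring_1 \<Rightarrow> 'a^'n^'m \<Rightarrow> 'a^'n^'m" where
  "matrix_smult c X = (\<chi> i j. c * X $ i $ j)"

lemma vector_space_matrix_smult:
  "vector_space (matrix_smult :: 'a::field \<Rightarrow> 'a^'n^'m \<Rightarrow> 'a^'n^'m)"
  by unfold_locales (simp_all add: matrix_smult_def vec_eq_iff algebra_simps)

text \<open>Subalgebras are not required to contain the identity matrix.\<close>

definition matrix_subalgebra :: "('a::field^'n^'n) set \<Rightarrow> bool" where
  "matrix_subalgebra S \<longleftrightarrow>
    module.subspace matrix_smult S \<and> (\<forall>X\<in>S. \<forall>Y\<in>S. X ** Y \<in> S)"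

definition real_matrix_subalgebra :: "(quat^'n^'n) set \<Rightarrow> bool" where
  "real_matrix_subalgebra S \<longleftrightarrow> subspace S \<and> (\<forall>X\<in>S. \<forall>Y\<in>S. X ** Y \<in> S)"

definition generated_algebra :: "'a::field^'n^'n \<Rightarrow> 'a^'n^'n \<Rightarrow> ('a^'n^'n) set" where
  "generated_algebra A B = matrix_subalgebra hull {A, B}"

definition generated_real_algebra :: "quat^'n^'n \<Rightarrow> quat^'n^'n \<Rightarrow> (quat^'n^'n) set" where
  "generated_real_algebra A B = real_matrix_subalgebra hull {A, B}"

lemma matrix_subalgebra_generated_algebra: "matrix_subalgebra (generated_algebra A B)"
proof -
  interpret vector_space "matrix_smult :: 'a \<Rightarrow> 'a^'b^'b \<Rightarrow> 'a^'b^'b"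
    by (rule vector_space_matrix_smult)
  show ?thesis
    unfolding generated_algebra_def
    by (rule hull_in) (auto simp: matrix_subalgebra_def subspace_def)
qed

lemma real_matrix_subalgebra_generated_real_algebra:
  "real_matrix_subalgebra (generated_real_algebra A B)"
  unfolding generated_real_algebra_def
  by (rule hull_in) (auto simp: real_matrix_subalgebra_def subspace_def)

definition right_subspace :: "(quat^'n) set \<Rightarrow> bool" where
  "right_subspace V \<longleftrightarrow>
    0 \<in> V \<and> (\<forall>v\<in>V. \<forall>w\<in>V. v + w \<in> V) \<and> (\<forall>v\<in>V. \<forall>q. (\<chi> i. v $ i * q) \<in> V)"

definition irreducible_algebra :: "(quat^'n^'n) set \<Rightarrow> bool" where
  "irreducible_algebra S \<longleftrightarrow>
    (\<forall>V. right_subspace V \<and> (\<forall>X\<in>S. \<forall>v\<in>V. X *v v \<in> V) \<longrightarrow> V = {0} \<or> V = UNIV)"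

definition matrices_over :: "'d set \<Rightarrow> ('d^'n^'n) set" where
  "matrices_over K = {X. \<forall>i j. X $ i $ j \<in> K}"

end

(* Conjugating by transvections in a central parameter t turns each matrix entry into a polynomial in
   t of degree at most two, so among 2n + 1 values of t some value keeps all nonzero off-diagonal
   entries nonzero; a similar matrix with the largest number of them has no zero off-diagonal entry.
   Together with the idempotents E_ii, which a generic diagonal matrix generates, such a matrix yields
   every matrix unit. Over the quaternions the diagonal matrix can moreover be chosen so that the
   generated algebra is always the full matrix ring. *)

theory Submission
  imports Defs
begin

section \<open>Matrix units and similarity\<close>

definition matrix_unit :: "'n \<Rightarrow> 'n \<Rightarrow> 'a \<Rightarrow> 'a::semiring_1^'n^'n" where
  "matrix_unit i j c = (\<chi> p q. if p = i \<and> q = j then c else 0)"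

definition diag_mat :: "('n \<Rightarrow> 'a) \<Rightarrow> 'a::semiring_1^'n^'n" where
  "diag_mat d = (\<chi> p q. if p = q then d p else 0)"

lemma matrix_unit_nth: "matrix_unit i j c $ p $ q = (if p = i \<and> q = j then c else 0)"
  by (simp add: matrix_unit_def)

lemma diag_mat_nth: "diag_mat d $ p $ q = (if p = q then d p else 0)"
  by (simp add: diag_mat_def)

lemma matrix_unit_mult_nth:
  "(matrix_unit i j c ** X) $ p $ q = (if p = i then c * X $ j $ q else 0)"
  by (simp add: matrix_matrix_mult_def matrix_unit_def if_distrib[where f = "\<lambda>x. x * _"] cong: if_cong)

lemma mult_matrix_unit_nth:
  "(X ** matrix_unit i j c) $ p $ q = (if q = j then X $ p $ i * c else 0)"
  by (simp add: matrix_matrix_mult_def matrix_unit_def if_distrib[where f = "\<lambda>x. _ * x"] cong: if_cong)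

lemma matrix_unit_mult:
  "matrix_unit i j c ** matrix_unit k l d = (if j = k then matrix_unit i l (c * d) else 0)"
  by (auto simp: vec_eq_iff matrix_unit_mult_nth matrix_unit_nth)

lemma diag_mat_mult: "diag_mat d ** diag_mat e = diag_mat (\<lambda>i. d i * e i)"
  by (simp add: vec_eq_iff matrix_matrix_mult_def diag_mat_def if_distrib[where f = "\<lambda>x. x * _"] cong: if_cong)

lemma matrix_add_rdistrib: "(A + B) ** C = A ** C + B ** (C :: 'a::semiring_1^'n^'n)"
  by (simp add: vec_eq_iff matrix_matrix_mult_def distrib_right sum.distrib)

lemma matrix_inv_unique:
  fixes P Q :: "'a::semiring_1^'n^'n"
  assumes "P ** Q = mat 1" "Q ** P = mat 1"
  shows "matrix_inv P = Q"
proof -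
  have "P ** matrix_inv P = mat 1 \<and> matrix_inv P ** P = mat 1"
    unfolding matrix_inv_def by (rule someI[of _ Q]) (use assms in simp)
  then have "matrix_inv P = (Q ** P) ** matrix_inv P" and "Q ** (P ** matrix_inv P) = Q"
    using assms by simp_all
  then show ?thesis by (simp add: matrix_mul_assoc)
qed

text \<open>The inverse is carried as an explicit matrix \<open>Q\<close>, so that conjugations
  compose by associativity alone and the choice behind \<open>matrix_inv\<close> stays out of the
  way.\<close>

definition similar_matrix :: "'a::semiring_1^'n^'n \<Rightarrow> 'a^'n^'n \<Rightarrow> bool" where
  "similar_matrix A A' \<longleftrightarrow> (\<exists>P Q. P ** Q = mat 1 \<and> Q ** P = mat 1 \<and> A' = P ** A ** Q)"

lemma similar_matrix_refl: "similar_matrix A A"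
  unfolding similar_matrix_def by (rule exI[of _ "mat 1"], rule exI[of _ "mat 1"]) simp

lemma similar_matrix_trans:
  assumes "similar_matrix A B" "similar_matrix B C"
  shows "similar_matrix A C"
proof -
  obtain P Q where P: "P ** Q = mat 1" "Q ** P = mat 1" "B = P ** A ** Q"
    using assms(1) by (auto simp: similar_matrix_def)
  obtain R S where R: "R ** S = mat 1" "S ** R = mat 1" "C = R ** B ** S"
    using assms(2) by (auto simp: similar_matrix_def)
  have "(R ** P) ** (Q ** S) = R ** (P ** Q) ** S" "(Q ** S) ** (R ** P) = Q ** (S ** R) ** P"
    by (simp_all add: matrix_mul_assoc)
  then have "(R ** P) ** (Q ** S) = mat 1" "(Q ** S) ** (R ** P) = mat 1"
    using P R by simp_all
  moreover have "C = (R ** P) ** A ** (Q ** S)"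
    using P R by (simp add: matrix_mul_assoc)
  ultimately show ?thesis unfolding similar_matrix_def by blast
qed

definition transvect :: "'n \<Rightarrow> 'n \<Rightarrow> 'a \<Rightarrow> 'a::ring_1^'n^'n \<Rightarrow> 'a^'n^'n" where
  "transvect k l t A = (mat 1 + matrix_unit k l t) ** A ** (mat 1 + matrix_unit k l (- t))"

text \<open>For \<open>k \<noteq> l\<close> the product of two matrix units at position
  \<open>(k, l)\<close> vanishes, so the two outer factors of \<open>transvect\<close> are inverse
  to each other, over any ring.\<close>

lemma similar_matrix_transvect:
  fixes A :: "'a::ring_1^'n^'n"
  assumes "k \<noteq> l"
  shows "similar_matrix A (transvect k l t A)"
proof -
  have "(mat 1 + matrix_unit k l s) ** (mat 1 + matrix_unit k l (- s)) = (mat 1 :: 'a^'n^'n)" for s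
    using assms by (simp add: matrix_add_rdistrib matrix_add_ldistrib matrix_unit_mult)
      (simp add: vec_eq_iff matrix_unit_nth)
  from this[of t] this[of "- t"] show ?thesis
    unfolding similar_matrix_def transvect_def by fastforce
qed

lemma transvect_nth:
  "transvect k l t A $ p $ q = A $ p $ q + (if p = k then t * A $ l $ q else 0)
     - (if q = l then A $ p $ k * t else 0) - (if p = k \<and> q = l then t * A $ l $ k * t else 0)"
  by (auto simp: transvect_def matrix_add_rdistrib matrix_add_ldistrib
      matrix_unit_mult_nth mult_matrix_unit_nth algebra_simps)

section \<open>Reaching nonzero off-diagonal entries\<close>

text \<open>Subtracting the equations of two different roots gives \<open>b = 0\<close>, and then
  \<open>a = 0\<close>; commutativity does not enter.\<close>

lemma card_roots_linear_le:
  fixes a b :: "'a::division_ring"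
  assumes "finite T" "a \<noteq> 0 \<or> b \<noteq> 0"
  shows "card {t \<in> T. a + t * b = 0} \<le> 1"
proof -
  have "s = t" if "a + s * b = 0" "a + t * b = 0" for s t
  proof -
    have "(s - t) * b = (a + s * b) - (a + t * b)" by (simp add: algebra_simps)
    then have "(s - t) * b = 0" using that by simp
    with assms that show ?thesis by auto
  qed
  then show ?thesis
    using assms(1) by (auto simp: card_le_Suc0_iff_eq)
qed

text \<open>Three distinct roots would force all coefficients to vanish, by divided differences.
  Centrality gives \<open>(x - r) * (x + r) = x * x - r * r\<close>; without it the count fails:
  \<open>x * x + 1\<close> has infinitely many quaternionic roots.\<close>

lemma card_roots_quadratic_le:
  fixes a b c :: "'a::division_ring"
  assumes "finite T" "a \<noteq> 0 \<or> b \<noteq> 0 \<or> c \<noteq> 0"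
    and central: "\<And>t x. t \<in> T \<Longrightarrow> t * x = x * t"
  shows "card {t \<in> T. a + t * b + t * t * c = 0} \<le> 2"
proof (rule ccontr)
  assume "\<not> ?thesis"
  then obtain U where "U \<subseteq> {t \<in> T. a + t * b + t * t * c = 0}" "card U = 3"
    using obtain_subset_with_card_n[of 3 "{t \<in> T. a + t * b + t * t * c = 0}"] by auto
  then obtain r s t where rst: "r \<noteq> s" "s \<noteq> t" "r \<noteq> t" "r \<in> T" "s \<in> T" "t \<in> T"
    and roots: "a + r * b + r * r * c = 0" "a + s * b + s * s * c = 0" "a + t * b + t * t * c = 0"
    by (auto simp: card_3_iff)
  have slope: "b + (x + r) * c = 0"
    if "a + x * b + x * x * c = 0" "x \<noteq> r" "x \<in> T" for x
  proof -
    have "(x - r) * (b + (x + r) * c)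
        = (a + x * b + x * x * c) - (a + r * b + r * r * c) + (x * r - r * x) * c"
      by (simp add: algebra_simps)
    then have "(x - r) * (b + (x + r) * c) = 0"
      using that roots central[of r x] rst by simp
    with that show ?thesis by simp
  qed
  \<comment> \<open>A second divided difference: the linear slope vanishes at both \<open>s\<close>
    and \<open>t\<close>.\<close>
  have "(s - t) * c = (b + (s + r) * c) - (b + (t + r) * c)"
    by (simp add: algebra_simps)
  then have "c = 0"
    using slope[of s] slope[of t] roots rst by simp
  moreover from this have "b = 0"
    using slope[of s] roots rst by simp
  ultimately show False
    using roots assms(2) by simp
qed

text \<open>The coefficients, as polynomials in the central parameter \<open>t\<close>, of the entries of
  \<^term>\<open>transvect k l t A\<close>.\<close>

definition transvect_coeffs :: "'n \<Rightarrow> 'n \<Rightarrow> 'a::ring_1^'n^'n \<Rightarrow> 'n \<Rightarrow> 'n \<Rightarrow> 'a \<times> 'a \<times> 'a" where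
  "transvect_coeffs k l A p q = (A $ p $ q,
     (if p = k then A $ l $ q else 0) - (if q = l then A $ p $ k else 0),
     if p = k \<and> q = l then - (A $ l $ k) else 0)"

text \<open>Only row \<open>k\<close> and column \<open>l\<close> change. A parameter avoiding the
  roots of all nonzero entry polynomials keeps every nonzero entry and also makes entry
  \<open>(i, j)\<close> nonzero, whose polynomial is nonzero although it vanishes at 0.\<close>

lemma transvect_increases_support:
  fixes A :: "'a::division_ring^'n^'n" and T :: "'a set"
  assumes T: "finite T" "2 * CARD('n) + 1 \<le> card T" "\<And>t x. t \<in> T \<Longrightarrow> t * x = x * t"
    and "k \<noteq> l" "i \<noteq> j" "A $ i $ j = 0" "transvect_coeffs k l A i j \<noteq> (0, 0, 0)"
  shows "\<exists>A'. similar_matrix A A' \<and>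
    {(p, q). p \<noteq> q \<and> A $ p $ q \<noteq> 0} \<subset> {(p, q). p \<noteq> q \<and> A' $ p $ q \<noteq> 0}"
proof -
  \<comment> \<open>The parameters to avoid. An entry whose polynomial is identically zero imposes
    no condition, hence the empty set.\<close>
  define R where "R p q = (if transvect_coeffs k l A p q = (0, 0, 0) then {}
    else {t \<in> T. transvect k l t A $ p $ q = 0})" for p q
  \<comment> \<open>Centrality moves \<open>t\<close> to the left of all coefficients.\<close>
  have entry: "transvect k l t A $ p $ q = (case transvect_coeffs k l A p q of
      (a, b, c) \<Rightarrow> a + t * b + t * t * c)" if "t \<in> T" for t p q
  proof -
    have "A $ r $ k * t = t * A $ r $ k" for r
      using T(3)[OF that] by simp
    moreover from this[of l] have "t * A $ l $ k * t = t * t * A $ l $ k"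
      by (simp add: mult.assoc)
    ultimately show ?thesis
      by (simp add: transvect_nth transvect_coeffs_def distrib_left right_diff_distrib)
  qed
  have R_kl: "card (R k l) \<le> 2"
  proof -
    obtain a b c where abc: "transvect_coeffs k l A k l = (a, b, c)" by (cases "transvect_coeffs k l A k l")
    have "{t \<in> T. transvect k l t A $ k $ l = 0} = {t \<in> T. a + t * b + t * t * c = 0}"
      using entry[of _ k l] abc by auto
    then show ?thesis
      using card_roots_quadratic_le[OF T(1) _ T(3), of a b c] abc by (auto simp: R_def)
  qed
  have R_line: "card (R p q) \<le> 1" if "\<not> (p = k \<and> q = l)" for p q
  proof -
    obtain a b c where abc: "transvect_coeffs k l A p q = (a, b, c)" by (cases "transvect_coeffs k l A p q")
    moreover from this that have c: "c = 0" by (auto simp: transvect_coeffs_def split: if_splits)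
    ultimately have "{t \<in> T. transvect k l t A $ p $ q = 0} = {t \<in> T. a + t * b = 0}"
      using entry[of _ p q] by auto
    then show ?thesis
      using card_roots_linear_le[OF T(1), of a b] abc c by (auto simp: R_def)
  qed
  let ?bad = "R k l \<union> (\<Union>q\<in>UNIV - {l}. R k q) \<union> (\<Union>p\<in>UNIV - {k}. R p l)"
  have "card (\<Union>q\<in>UNIV - {l}. R k q) \<le> (\<Sum>q\<in>UNIV - {l}. card (R k q))"
    by (rule card_UN_le) simp
  also have "\<dots> \<le> (\<Sum>q\<in>UNIV - {l}. 1)"
    by (intro sum_mono R_line) auto
  finally have row: "card (\<Union>q\<in>UNIV - {l}. R k q) \<le> CARD('n) - 1"
    by (simp add: card_Diff_singleton)
  have "card (\<Union>p\<in>UNIV - {k}. R p l) \<le> (\<Sum>p\<in>UNIV - {k}. card (R p l))"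
    by (rule card_UN_le) simp
  also have "\<dots> \<le> (\<Sum>p\<in>UNIV - {k}. 1)"
    by (intro sum_mono R_line) auto
  finally have col: "card (\<Union>p\<in>UNIV - {k}. R p l) \<le> CARD('n) - 1"
    by (simp add: card_Diff_singleton)
  \<comment> \<open>With n the size, at most 2 + (n - 1) + (n - 1) = 2n parameters are bad, one
    fewer than \<open>T\<close> is known to contain; positivity of n makes the truncated subtraction
    exact.\<close>
  have "CARD('n) > 0" by simp
  then have "card ?bad < card T"
    using row col R_kl T(2) card_Un_le[of "R k l \<union> (\<Union>q\<in>UNIV - {l}. R k q)" "\<Union>p\<in>UNIV - {k}. R p l"]
      card_Un_le[of "R k l" "\<Union>q\<in>UNIV - {l}. R k q"] by linarith
  moreover have "finite ?bad"
    using T(1) by (auto simp: R_def)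
  ultimately have "\<not> T \<subseteq> ?bad"
    by (meson card_mono leD)
  then obtain t where t: "t \<in> T" "t \<notin> ?bad" by blast
  have nonzero: "transvect k l t A $ p $ q \<noteq> 0" if "transvect_coeffs k l A p q \<noteq> (0, 0, 0)" for p q
  proof (cases "p = k \<or> q = l")
    case True
    then have "t \<notin> R p q" using t(2) by auto
    with that t(1) show ?thesis by (simp add: R_def)
  next
    case False
    with that show ?thesis by (simp add: entry[OF t(1)] transvect_coeffs_def)
  qed
  let ?supp = "\<lambda>X :: 'a^'n^'n. {(p, q). p \<noteq> q \<and> X $ p $ q \<noteq> 0}"
  have "?supp A \<subseteq> ?supp (transvect k l t A)"
    using nonzero by (auto simp: transvect_coeffs_def)
  moreover have "(i, j) \<in> ?supp (transvect k l t A)" "(i, j) \<notin> ?supp A"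
    using nonzero[of i j] assms by auto
  ultimately have "?supp A \<subset> ?supp (transvect k l t A)" by blast
  with similar_matrix_transvect[OF \<open>k \<noteq> l\<close>] show ?thesis by blast
qed

text \<open>A zero at \<open>(p, q)\<close> is tested against three kinds of transvections:
  \<open>(p, q)\<close> itself forces a zero at \<open>(q, p)\<close> and equal diagonal entries,
  \<open>(p, l)\<close> clears column \<open>q\<close>, and \<open>(k, q)\<close> clears row
  \<open>p\<close>, both off the diagonal.\<close>

lemma scalar_if_no_transvect:
  fixes A :: "'a::ring_1^'n^'n"
  assumes "i \<noteq> j" "A $ i $ j = 0"
    and none: "\<And>p q k l. p \<noteq> q \<Longrightarrow> A $ p $ q = 0 \<Longrightarrow> k \<noteq> l \<Longrightarrow> transvect_coeffs k l A p q = (0, 0, 0)"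
  shows "A = mat (A $ j $ j)"
proof -
  have swap: "A $ q $ p = 0" and eq: "A $ p $ p = A $ q $ q" if "p \<noteq> q" "A $ p $ q = 0" for p q
    using none[OF that that(1)] that by (auto simp: transvect_coeffs_def)
  have col: "A $ l $ q = 0" if "p \<noteq> q" "A $ p $ q = 0" "l \<noteq> q" for p q l
    using none[OF that(1,2), of p l] that by (cases "l = p") (auto simp: transvect_coeffs_def)
  have row: "A $ p $ k = 0" if "p \<noteq> q" "A $ p $ q = 0" "k \<noteq> p" for p q k
    using none[OF that(1,2), of k q] that by (cases "k = q") (auto simp: transvect_coeffs_def)
  \<comment> \<open>The zero at \<open>(i, j)\<close> spreads along column \<open>j\<close> to every
    row \<open>p \<noteq> j\<close>, and through \<open>(j, i)\<close> to row
    \<open>j\<close>.\<close>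
  have "A $ p $ q = 0" if "p \<noteq> q" for p q
  proof (cases "p = j")
    case True
    with row[of j i q] swap[of i j] assms(1,2) that show ?thesis by auto
  next
    case False
    with row[of p j q] col[of i j p] assms(1,2) that show ?thesis by auto
  qed
  moreover from this have "A $ p $ p = A $ j $ j" for p
    using eq[of p j] by (cases "p = j") auto
  ultimately show ?thesis
    by (auto simp: vec_eq_iff mat_def)
qed

text \<open>In a nonscalar similar matrix with the largest off-diagonal support, a zero off the
  diagonal would allow a transvection enlarging the support, or else make the matrix scalar.\<close>

theorem similar_nonzero_off_diagonal:
  fixes A :: "'a::division_ring^'n^'n" and T :: "'a set"
  assumes "finite T" "2 * CARD('n) + 1 \<le> card T" "\<And>t x. t \<in> T \<Longrightarrow> t * x = x * t"
    and nonscalar: "\<nexists>c. A = mat c"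
  shows "\<exists>A'. similar_matrix A A' \<and> (\<forall>p q. p \<noteq> q \<longrightarrow> A' $ p $ q \<noteq> 0)"
proof -
  define supp where "supp X = {(p, q). p \<noteq> q \<and> X $ p $ q \<noteq> 0}" for X :: "'a^'n^'n"
  have "card (supp X) \<le> CARD('n \<times> 'n)" for X
    by (intro card_mono) auto
  then have "\<forall>X. similar_matrix A X \<longrightarrow> card (supp X) < Suc CARD('n \<times> 'n)"
    by (simp add: less_Suc_eq_le)
  then obtain B where B: "similar_matrix A B"
    and B_max: "\<And>X. similar_matrix A X \<Longrightarrow> card (supp X) \<le> card (supp B)"
    using ex_has_greatest_nat[of "similar_matrix A" A "\<lambda>X. card (supp X)"]
      similar_matrix_refl[of A] by metis
  \<comment> \<open>The maximiser \<open>B\<close> could be scalar, since noncommutative similarity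
    can turn a nonscalar matrix into \<open>mat c\<close>: over the quaternions diag(i, j) is
    similar to iI. In that case the maximal support is empty, and \<open>A\<close> itself is a
    nonscalar maximiser.\<close>
  obtain A' where A': "similar_matrix A A'" "\<nexists>c. A' = mat c"
    and max: "\<And>X. similar_matrix A X \<Longrightarrow> card (supp X) \<le> card (supp A')"
  proof (cases "supp B = {}")
    case True
    have "card (supp X) \<le> card (supp A)" if "similar_matrix A X" for X
      using B_max[OF that] True by simp
    with nonscalar similar_matrix_refl show ?thesis by (intro that[of A])
  next
    case False
    then have "\<nexists>c. B = mat c"
      by (auto simp: supp_def mat_def)
    with B B_max show ?thesis by (intro that[of B])
  qed
  have "transvect_coeffs k l A' p q = (0, 0, 0)" if pq: "p \<noteq> q" "A' $ p $ q = 0" "k \<noteq> l" for p q k l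
  proof (rule ccontr)
    assume "transvect_coeffs k l A' p q \<noteq> (0, 0, 0)"
    then obtain X where X: "similar_matrix A' X" "supp A' \<subset> supp X"
      using transvect_increases_support[OF assms(1-3) pq(3,1,2)] by (auto simp: supp_def)
    then have "card (supp A') < card (supp X)"
      by (intro psubset_card_mono) auto
    then show False
      using max[of X] similar_matrix_trans[OF A'(1) X(1)] by simp
  qed
  then have "A' $ p $ q \<noteq> 0" if "p \<noteq> q" for p q
    using scalar_if_no_transvect[of p q A'] that A'(2) by metis
  with A' show ?thesis by blast
qed

section \<open>Algebras containing a diagonal matrix\<close>

lemma matrix_eq_sum_matrix_unit: "A = (\<Sum>i\<in>UNIV. \<Sum>j\<in>UNIV. matrix_unit i j (A $ i $ j))"
  for A :: "'a::semiring_1^'n^'n"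
proof -
  have "(\<Sum>i\<in>UNIV. \<Sum>j\<in>UNIV. if p = i \<and> q = j then A $ i $ j else 0)
      = (\<Sum>i\<in>UNIV. if p = i then A $ i $ q else 0)" for p q
    by (intro sum.cong) auto
  then show ?thesis
    by (simp add: vec_eq_iff matrix_unit_nth)
qed

text \<open>The common setting of both halves: \<open>Z\<close> is the coefficient field, either the
  whole field or the reals inside the quaternions.\<close>

locale central_subfield =
  fixes Z :: "'a::division_ring set"
  assumes one: "1 \<in> Z"
    and diff: "\<And>x y. x \<in> Z \<Longrightarrow> y \<in> Z \<Longrightarrow> x - y \<in> Z"
    and mult: "\<And>x y. x \<in> Z \<Longrightarrow> y \<in> Z \<Longrightarrow> x * y \<in> Z"
    and inverse: "\<And>x. x \<in> Z \<Longrightarrow> inverse x \<in> Z"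
    and central: "\<And>c x. c \<in> Z \<Longrightarrow> c * x = x * c"
begin

definition subalgebra :: "('a^'n^'n) set \<Rightarrow> bool" where
  "subalgebra S \<longleftrightarrow> 0 \<in> S \<and> (\<forall>X\<in>S. \<forall>Y\<in>S. X + Y \<in> S \<and> X ** Y \<in> S) \<and>
    (\<forall>c\<in>Z. \<forall>X\<in>S. matrix_smult c X \<in> S)"

lemma subalgebraD:
  assumes "subalgebra S"
  shows "0 \<in> S" "X \<in> S \<Longrightarrow> Y \<in> S \<Longrightarrow> X + Y \<in> S" "X \<in> S \<Longrightarrow> Y \<in> S \<Longrightarrow> X ** Y \<in> S"
    "c \<in> Z \<Longrightarrow> X \<in> S \<Longrightarrow> matrix_smult c X \<in> S"
  using assms by (auto simp: subalgebra_def)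

text \<open>The product \<open>P ** Q\<close> cancels between two conjugates, and central scalars
  pass through \<open>Q\<close>.\<close>

lemma subalgebra_conjugate:
  fixes S :: "('a^'n^'n) set" and P Q :: "'a^'n^'n"
  assumes S: "subalgebra S" and PQ: "P ** Q = mat 1"
  shows "subalgebra {X. Q ** X ** P \<in> S}"
proof -
  have smult: "Q ** matrix_smult c X ** P = matrix_smult c (Q ** X ** P)" if "c \<in> Z" for c X
  proof -
    have "x * (c * y) = c * (x * y)" for x y
      using central[OF that] by (metis mult.assoc)
    then have "Q ** matrix_smult c X = matrix_smult c (Q ** X)"
      by (simp add: vec_eq_iff matrix_matrix_mult_def matrix_smult_def sum_distrib_left)
    moreover have "matrix_smult c Y ** P = matrix_smult c (Y ** P)" for Y :: "'a^'n^'n"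
      by (simp add: vec_eq_iff matrix_matrix_mult_def matrix_smult_def sum_distrib_left mult.assoc)
    ultimately show ?thesis by simp
  qed
  have mult: "Q ** (X ** Y) ** P = (Q ** X ** P) ** (Q ** Y ** P)" for X Y
  proof -
    have "(Q ** X ** P) ** (Q ** Y ** P) = Q ** X ** (P ** Q) ** Y ** P"
      by (simp add: matrix_mul_assoc)
    then show ?thesis by (simp add: PQ matrix_mul_assoc)
  qed
  have "Q ** 0 ** P = 0"
    by (simp add: vec_eq_iff matrix_matrix_mult_def)
  then show ?thesis
    using S by (simp add: subalgebra_def smult mult matrix_add_ldistrib matrix_add_rdistrib)
qed

text \<open>Lagrange interpolation by polynomials without constant term, as the identity matrix need
  not lie in \<open>S\<close>; this is why the \<open>d i\<close> must be nonzero.\<close>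

lemma diagonal_idempotent_mem:
  assumes S: "subalgebra S" and D: "diag_mat d \<in> S"
    and d: "inj d" "\<And>i. d i \<in> Z" "\<And>i. d i \<noteq> 0"
  shows "matrix_unit i i 1 \<in> S"
proof -
  \<comment> \<open>The witness built by induction is \<open>d k\<close> times the product of
    \<open>d k - d j\<close> over \<open>j\<close> in \<open>J\<close>.\<close>
  have "\<exists>e. diag_mat e \<in> S \<and> (\<forall>k. e k \<in> Z) \<and> (\<forall>k. e k = 0 \<longleftrightarrow> k \<in> J)" for J
    using finite[of J]
  proof (induction J)
    case empty
    show ?case using D d by (intro exI[of _ d]) simp
  next
    case (insert j J)
    then obtain e where e: "diag_mat e \<in> S" "\<And>k. e k \<in> Z" "\<And>k. e k = 0 \<longleftrightarrow> k \<in> J"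
      by blast
    \<comment> \<open>Negation is obtained as (1 - 1) - \<open>d j\<close>.\<close>
    have neg: "- d j \<in> Z"
      using diff[OF diff[OF one one] d(2)[of j]] by simp
    have "diag_mat (\<lambda>k. e k * (d k - d j)) = diag_mat e ** diag_mat d + matrix_smult (- d j) (diag_mat e)"
      using central[OF d(2)[of j]]
      by (simp add: vec_eq_iff diag_mat_mult diag_mat_nth matrix_smult_def right_diff_distrib)
    then have "diag_mat (\<lambda>k. e k * (d k - d j)) \<in> S"
      using subalgebraD[OF S] e(1) D neg by simp
    moreover have "e k * (d k - d j) = 0 \<longleftrightarrow> k \<in> insert j J" for k
      using e(3) d(1) by (auto simp: inj_eq)
    ultimately show ?case
      using e(2) d(2) by (intro exI[of _ "\<lambda>k. e k * (d k - d j)"]) (simp add: mult diff)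
  qed
  from this[of "UNIV - {i}"] obtain e where e: "diag_mat e \<in> S" "\<And>k. e k \<in> Z" "\<And>k. e k = 0 \<longleftrightarrow> k \<noteq> i"
    by auto
  have "matrix_unit i i 1 = matrix_smult (inverse (e i)) (diag_mat e)"
    using e(3) by (auto simp: vec_eq_iff matrix_unit_nth diag_mat_nth matrix_smult_def)
  then show ?thesis
    using subalgebraD(4)[OF S inverse[OF e(2)] e(1)] by simp
qed

lemma matrix_unit_entry_mem:
  assumes "subalgebra S" "A \<in> S" "\<And>i. matrix_unit i i 1 \<in> S"
  shows "matrix_unit p q (A $ p $ q) \<in> S"
proof -
  have "matrix_unit p q (A $ p $ q) = matrix_unit p p 1 ** A ** matrix_unit q q 1"
    by (auto simp: vec_eq_iff matrix_unit_nth matrix_unit_mult_nth mult_matrix_unit_nth)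
  with assms show ?thesis by (simp add: subalgebraD)
qed

text \<open>One full corner suffices: multiplying it by the nonzero entries of column
  \<open>r\<close> and row \<open>r\<close> of \<open>A\<close>, with their inverses absorbed into
  the corner, fills that column and row, and a column unit times a row unit is an arbitrary matrix
  unit.\<close>

lemma subalgebra_eq_UNIV:
  fixes S :: "('a^'n^'n) set"
  assumes S: "subalgebra S" and A: "A \<in> S" "\<And>p q. p \<noteq> q \<Longrightarrow> A $ p $ q \<noteq> 0"
    and idem: "\<And>i. matrix_unit i i 1 \<in> S" and corner: "\<And>c. matrix_unit r r c \<in> S"
  shows "S = UNIV"
proof -
  note entry = matrix_unit_entry_mem[OF S A(1) idem]
  have col: "matrix_unit p r c \<in> S" for p c
  proof (cases "p = r")
    case False
    then have "matrix_unit p r c = matrix_unit p r (A $ p $ r) ** matrix_unit r r (inverse (A $ p $ r) * c)"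
      using A(2) by (simp add: matrix_unit_mult flip: mult.assoc)
    then show ?thesis using subalgebraD(3)[OF S entry corner] by simp
  qed (simp add: corner)
  have row: "matrix_unit r q c \<in> S" for q c
  proof (cases "q = r")
    case False
    then have "matrix_unit r q c = matrix_unit r r (c * inverse (A $ r $ q)) ** matrix_unit r q (A $ r $ q)"
      using A(2) by (simp add: matrix_unit_mult mult.assoc)
    then show ?thesis using subalgebraD(3)[OF S corner entry] by simp
  qed (simp add: corner)
  have unit: "matrix_unit p q c \<in> S" for p q c
    using subalgebraD(3)[OF S col[of p c] row[of q 1]] by (simp add: matrix_unit_mult)
  have sum: "(\<Sum>i\<in>I. f i) \<in> S" if "\<And>i. f i \<in> S" for I :: "'n set" and f
    using finite[of I] by induction (simp_all add: subalgebraD[OF S] that)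
  have "X \<in> S" for X
    by (subst matrix_eq_sum_matrix_unit) (intro sum unit)
  then show ?thesis by blast
qed

end

section \<open>Diagonalisable matrices and transport of generation along a similarity\<close>

lemma diagonal_matrix_diag_mat: "diagonal_matrix (diag_mat d)"
  by (simp add: diagonal_matrix_def diag_mat_nth)

lemma diagonalisable_conjugate:
  fixes P Q D :: "'a::semiring_1^'n^'n"
  assumes "P ** Q = mat 1" "Q ** P = mat 1" "diagonal_matrix D"
  shows "diagonalisable (Q ** D ** P)"
  using assms matrix_inv_unique[OF assms(1,2)] by (auto simp: diagonalisable_def invertible_def)

text \<open>The matrices whose conjugate lies in \<open>S\<close> form a subalgebra containing
  \<open>A'\<close> and \<open>D\<close>, hence are all matrices; conjugating back gives all of
  \<open>S\<close>.\<close>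

lemma (in central_subfield) conjugate_generates:
  fixes A A' P Q D :: "'a^'n^'n"
  assumes PQ: "P ** Q = mat 1" "Q ** P = mat 1" "A' = P ** A ** Q"
    and gen: "\<And>S. subalgebra S \<Longrightarrow> A' \<in> S \<Longrightarrow> D \<in> S \<Longrightarrow> S = UNIV"
    and S: "subalgebra S" "A \<in> S" "Q ** D ** P \<in> S"
  shows "S = UNIV"
proof -
  have *: "Q ** (P ** X ** Q) ** P = X" for X
  proof -
    have "Q ** (P ** X ** Q) ** P = (Q ** P) ** X ** (Q ** P)"
      by (simp add: matrix_mul_assoc)
    then show ?thesis by (simp add: PQ)
  qed
  have "{X. Q ** X ** P \<in> S} = UNIV"
    using gen[OF subalgebra_conjugate[OF S(1) PQ(1)]] S * by (simp add: PQ(3))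
  then have "Q ** (P ** X ** Q) ** P \<in> S" for X
    by blast
  then show ?thesis using * by auto
qed

section \<open>Matrices over a field\<close>

lemma central_subfield_UNIV: "central_subfield (UNIV :: 'a::field set)"
  by unfold_locales (simp_all add: mult.commute)

lemma subalgebra_UNIV_generated_algebra:
  "central_subfield.subalgebra UNIV (generated_algebra A B)"
proof -
  interpret vector_space "matrix_smult :: 'a \<Rightarrow> 'a^'b^'b \<Rightarrow> 'a^'b^'b"
    by (rule vector_space_matrix_smult)
  show ?thesis
    using matrix_subalgebra_generated_algebra[of A B]
    by (simp add: matrix_subalgebra_def subspace_def
        central_subfield.subalgebra_def[OF central_subfield_UNIV])
qed

lemma generators_mem_generated_algebra:
  "A \<in> generated_algebra A B" "B \<in> generated_algebra A B"
  using hull_subset[of "{A, B}" matrix_subalgebra] by (auto simp: generated_algebra_def)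

theorem field_generator:
  fixes A :: "'a::field^'n^'n"
  assumes large: "infinite (UNIV :: 'a set) \<or> 2 * CARD('n) + 1 \<le> card (UNIV :: 'a set)"
    and nonscalar: "\<nexists>c. A = mat c"
  shows "\<exists>B. diagonalisable B \<and> generated_algebra A B = UNIV"
proof -
  interpret K: central_subfield "UNIV :: 'a set"
    by (rule central_subfield_UNIV)
  \<comment> \<open>Infinite sets have \<open>card\<close> 0, so the second alternative of
    \<open>large\<close> makes the field finite and \<open>T\<close> can be the whole field.\<close>
  obtain T :: "'a set" where T: "finite T" "2 * CARD('n) + 1 \<le> card T"
    using large infinite_arbitrarily_large[of "UNIV :: 'a set" "2 * CARD('n) + 1"] card_ge_0_finite
    by (metis Suc_eq_plus1 le_refl less_le_trans zero_less_Suc)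
  then obtain A' where "similar_matrix A A'" and off: "\<And>p q. p \<noteq> q \<Longrightarrow> A' $ p $ q \<noteq> 0"
    using similar_nonzero_off_diagonal[OF T _ nonscalar] by (auto simp: mult.commute)
  then obtain P Q where PQ: "P ** Q = mat 1" "Q ** P = mat 1" "A' = P ** A ** Q"
    by (auto simp: similar_matrix_def)
  \<comment> \<open>Removing 0 still leaves enough elements for distinct nonzero diagonal
    entries.\<close>
  have "CARD('n) \<le> card (T - {0})"
    using T by (auto simp: card_Diff_singleton_if)
  then obtain d :: "'n \<Rightarrow> 'a" where d: "inj d" "range d \<subseteq> T - {0}"
    using card_le_inj[of "UNIV :: 'n set" "T - {0}"] T(1) by auto
  have gen: "S = UNIV" if S: "K.subalgebra S" "A' \<in> S" "diag_mat d \<in> S" for S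
  proof -
    have "d i \<noteq> 0" for i using d(2) by blast
    then have idem: "matrix_unit i i 1 \<in> S" for i
      using K.diagonal_idempotent_mem[OF S(1,3) d(1)] by simp
    \<comment> \<open>Over a field the corner is filled by scalar multiples of its
      idempotent.\<close>
    have "matrix_unit r r c = matrix_smult c (matrix_unit r r 1)" for r and c :: 'a
      by (simp add: vec_eq_iff matrix_unit_nth matrix_smult_def)
    then have "matrix_unit r r c \<in> S" for r c
      using K.subalgebraD(4)[OF S(1) _ idem] by (metis UNIV_I)
    then show ?thesis
      by (intro K.subalgebra_eq_UNIV[OF S(1,2) off idem])
  qed
  have "generated_algebra A (Q ** diag_mat d ** P) = UNIV"
    by (rule K.conjugate_generates[OF PQ gen])
      (auto intro: subalgebra_UNIV_generated_algebra generators_mem_generated_algebra)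
  moreover have "diagonalisable (Q ** diag_mat d ** P)"
    by (rule diagonalisable_conjugate[OF PQ(1,2) diagonal_matrix_diag_mat])
  ultimately show ?thesis by blast
qed

section \<open>Quaternionic matrices\<close>

abbreviation quat_i :: quat where "quat_i \<equiv> Quat 0 1 0 0"
abbreviation quat_j :: quat where "quat_j \<equiv> Quat 0 0 1 0"

lemma of_real_quat: "of_real r = Quat r 0 0 0"
  by (simp add: of_real_def quat_defs)

lemma quat_in_Reals_iff: "q \<in> \<real> \<longleftrightarrow> Im1 q = 0 \<and> Im2 q = 0 \<and> Im3 q = 0"
  by (auto simp: Reals_def of_real_quat quat_eq_iff image_iff)

text \<open>The units i and j generate the quaternions, so whatever commutes with both is central,
  that is, real.\<close>

lemma noncommuting_unit:
  assumes "q \<notin> \<real>"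
  shows "\<exists>u\<in>{quat_i, quat_j}. u * q \<noteq> q * u"
proof -
  have "quat_i * q \<noteq> q * quat_i \<or> quat_j * q \<noteq> q * quat_j"
    using assms by (auto simp: quat_in_Reals_iff quat_eq_iff times_quat_def)
  then show ?thesis by blast
qed

text \<open>If both products were real, say \<open>s\<close> and \<open>t\<close>, the combination
  \<open>t\<close> i - \<open>s\<close> j would be sent to \<open>t s - s t = 0\<close>. Since i and
  j are independent, \<open>t = 0\<close>, contradicting that \<open>c * quat_j * b\<close> is a
  product of nonzero factors.\<close>

lemma nonreal_sandwich:
  assumes "c \<noteq> 0" "b \<noteq> 0"
  shows "\<exists>v\<in>{quat_i, quat_j}. c * v * b \<notin> \<real>"
proof (rule ccontr)
  assume "\<not> ?thesis"
  then obtain s t where s: "c * quat_i * b = of_real s" and t: "c * quat_j * b = of_real t"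
    by (auto elim!: Reals_cases)
  have "c * (t *\<^sub>R quat_i - s *\<^sub>R quat_j) * b = t *\<^sub>R (c * quat_i * b) - s *\<^sub>R (c * quat_j * b)"
    by (simp add: algebra_simps)
  then have "c * (t *\<^sub>R quat_i - s *\<^sub>R quat_j) * b = 0"
    by (simp add: s t of_real_def mult.commute)
  then have "t *\<^sub>R quat_i - s *\<^sub>R quat_j = 0"
    using assms by simp
  then have "t = 0"
    by (simp add: quat_eq_iff quat_defs)
  with t assms have "quat_j = 0"
    by simp
  then show False
    by (simp add: zero_quat_def)
qed

text \<open>The commutator \<open>y\<close> of \<open>u\<close> and \<open>x\<close> is orthogonal
  to 1 and \<open>u\<close>, so \<open>u * u = - 1\<close>, \<open>u\<close>, \<open>y\<close> and
  \<open>u * y\<close> form an orthogonal real basis inside \<open>K\<close>, without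
  \<open>1 \<in> K\<close> being assumed.\<close>

lemma noncommuting_generate_quat:
  assumes K: "subspace K" "\<And>x y. x \<in> K \<Longrightarrow> y \<in> K \<Longrightarrow> x * y \<in> K"
    and u: "u \<in> {quat_i, quat_j}" "u \<in> K" and x: "x \<in> K" "u * x \<noteq> x * u"
  shows "q \<in> K"
proof -
  define y where "y = u * x - x * u"
  define N where "N = norm_sq_quat y"
  have mem: "u * u \<in> K" "y \<in> K" "u * y \<in> K"
    using K u x by (auto simp: y_def subspace_diff)
  have "N \<noteq> 0"
    using x by (simp add: N_def y_def norm_sq_quat_eq_0_iff)
  have "\<exists>a b c d. q = a *\<^sub>R (u * u) + b *\<^sub>R u + (c / N) *\<^sub>R y + (d / N) *\<^sub>R (u * y)"
    using u(1)
  proof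
    assume u: "u = quat_i"
    \<comment> \<open>The last two coefficients are the inner products of \<open>q\<close> with
      \<open>y\<close> and \<open>u * y\<close>, divided by their common squared norm
      \<open>N\<close>; the sign of the first comes from \<open>u * u = - 1\<close>.\<close>
    have "q = (- Re0 q) *\<^sub>R (u * u) + Im1 q *\<^sub>R u + ((Im2 y * Im2 q + Im3 y * Im3 q) / N) *\<^sub>R y
        + ((Im2 y * Im3 q - Im3 y * Im2 q) / N) *\<^sub>R (u * y)"
    proof -
      have "Re0 y = 0" "Im1 y = 0" "N = (Im2 y)\<^sup>2 + (Im3 y)\<^sup>2"
        by (simp_all add: y_def N_def norm_sq_quat_def u quat_defs)
      note y = this
      show ?thesis
        using \<open>N \<noteq> 0\<close> by (simp add: u quat_eq_iff quat_defs y(1,2) field_simps)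
          (simp add: y(3) power2_eq_square algebra_simps)
    qed
    then show ?thesis by blast
  next
    assume "u \<in> {quat_j}"
    then have u: "u = quat_j" by simp
    have "q = (- Re0 q) *\<^sub>R (u * u) + Im2 q *\<^sub>R u + ((Im1 y * Im1 q + Im3 y * Im3 q) / N) *\<^sub>R y
        + ((Im3 y * Im1 q - Im1 y * Im3 q) / N) *\<^sub>R (u * y)"
    proof -
      have "Re0 y = 0" "Im2 y = 0" "N = (Im1 y)\<^sup>2 + (Im3 y)\<^sup>2"
        by (simp_all add: y_def N_def norm_sq_quat_def u quat_defs)
      note y = this
      show ?thesis
        using \<open>N \<noteq> 0\<close> by (simp add: u quat_eq_iff quat_defs y(1,2) field_simps)
          (simp add: y(3) power2_eq_square algebra_simps)
    qed
    then show ?thesis by blast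
  qed
  then show ?thesis
    using mem u(2) K(1) by (auto intro!: subspace_add subspace_scale)
qed

section \<open>Real algebras of quaternionic matrices\<close>

lemma central_subfield_Reals: "central_subfield (\<real> :: quat set)"
  by unfold_locales
    (simp_all add: quat_in_Reals_iff quat_eq_iff quat_defs inverse_quat_def cnj_quat_def)

lemma matrix_smult_of_real: "matrix_smult (of_real r) X = r *\<^sub>R X" for X :: "quat^'n^'m"
  by (simp add: vec_eq_iff matrix_smult_def flip: scaleR_conv_of_real)

lemma subalgebra_Reals_iff:
  "central_subfield.subalgebra \<real> S \<longleftrightarrow> real_matrix_subalgebra S"
  unfolding central_subfield.subalgebra_def[OF central_subfield_Reals]
  by (auto simp: real_matrix_subalgebra_def subspace_def Reals_def matrix_smult_of_real)

lemma generators_mem_generated_real_algebra: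
  "A \<in> generated_real_algebra A B" "B \<in> generated_real_algebra A B"
  using hull_subset[of "{A, B}" real_matrix_subalgebra] by (auto simp: generated_real_algebra_def)

lemma quat_similar_nonzero_off_diagonal:
  fixes A :: "quat^'n^'n"
  assumes nonscalar: "\<nexists>r. A = mat (of_real r)"
  shows "\<exists>A'. similar_matrix A A' \<and> (\<forall>p q. p \<noteq> q \<longrightarrow> A' $ p $ q \<noteq> 0) \<and> (\<nexists>r. A' = mat (of_real r))"
proof (cases "\<exists>k l :: 'n. k \<noteq> l")
  case False
  with nonscalar similar_matrix_refl[of A] show ?thesis by blast
next
  case True
  then obtain k l :: 'n where kl: "k \<noteq> l" by blast
  obtain A0 where A0: "similar_matrix A A0" "\<nexists>c. A0 = mat c"
  proof (cases "\<exists>c. A = mat c")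
    case True
    then obtain c where c: "A = mat c" by blast
    with nonscalar have "c \<notin> \<real>" by (auto elim!: Reals_cases)
    \<comment> \<open>The entry at \<open>(k, l)\<close> of the transvected matrix
      \<open>mat c\<close> is \<open>t * c - c * t\<close>.\<close>
    then obtain t where "t * c \<noteq> c * t" using noncommuting_unit by blast
    then have "transvect k l t A $ k $ l \<noteq> 0"
      using kl by (simp add: transvect_nth c mat_def)
    then have "\<nexists>c. transvect k l t A = mat c"
      using kl by (auto simp: mat_def)
    with that show ?thesis using similar_matrix_transvect[OF kl] by blast
  qed (use that similar_matrix_refl in blast)
  have "infinite (\<real> :: quat set)"
    unfolding Reals_def by (auto dest!: finite_imageD simp: inj_on_def infinite_UNIV_char_0)
  then obtain T :: "quat set" where T: "finite T" "card T = 2 * CARD('n) + 1" "T \<subseteq> \<real>"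
    using infinite_arbitrarily_large by blast
  then have "2 * CARD('n) + 1 \<le> card T" "\<And>t x. t \<in> T \<Longrightarrow> t * x = x * t"
    using central_subfield.central[OF central_subfield_Reals] by auto
  then obtain A' where A': "similar_matrix A0 A'" "\<forall>p q. p \<noteq> q \<longrightarrow> A' $ p $ q \<noteq> 0"
    using similar_nonzero_off_diagonal[OF T(1) _ _ A0(2)] by blast
  moreover from this kl have "\<nexists>r. A' = mat (of_real r)"
    by (auto simp: mat_def)
  ultimately show ?thesis
    using similar_matrix_trans[OF A0(1)] by blast
qed

text \<open>The entries \<open>d k\<close> are scaled square roots of \<open>- 1\<close>, so that the squared diagonal
  matrix is real with distinct entries and yields the diagonal idempotents. A corner then
  contains two non-commuting quaternions.\<close>

lemma quat_diagonal_generator: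
  fixes A :: "quat^'n^'n"
  assumes off: "\<And>p q. p \<noteq> q \<Longrightarrow> A $ p $ q \<noteq> 0" and nonscalar: "\<nexists>r. A = mat (of_real r)"
  obtains d where "\<And>S. real_matrix_subalgebra S \<Longrightarrow> A \<in> S \<Longrightarrow> diag_mat d \<in> S \<Longrightarrow> S = UNIV"
proof -
  interpret R: central_subfield "\<real> :: quat set"
    by (rule central_subfield_Reals)
  obtain f :: "'n \<Rightarrow> nat" where f: "inj f"
    using finite_imp_inj_to_nat_seg[of "UNIV :: 'n set"] by auto
  \<comment> \<open>The shift by 1 makes the scales positive, so that their squares are nonzero and
    distinct.\<close>
  define s where "s k = real (f k) + 1" for k
  have s: "s k > 0" for k
    by (simp add: s_def)
  have inj_s: "s k = s l \<longleftrightarrow> k = l" for k l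
    using f by (simp add: s_def inj_eq)
  define r :: 'n where "r = undefined"
  \<comment> \<open>A nonreal \<open>x\<close> in corner \<open>r\<close> comes from the path r, j,
    r through another index \<open>j\<close>, or, in size 1, from the single entry. It is reached
    with \<open>v\<close> placed only at indices other than \<open>r\<close>, which leaves the
    diagonal unit at \<open>r\<close> free.\<close>
  obtain v x where v: "v \<in> {quat_i, quat_j}" and x: "x \<notin> \<real>"
    and x_mem: "\<And>S. R.subalgebra S \<Longrightarrow> A \<in> S \<Longrightarrow> (\<And>k. matrix_unit k k 1 \<in> S) \<Longrightarrow>
      (\<And>k. k \<noteq> r \<Longrightarrow> matrix_unit k k v \<in> S) \<Longrightarrow> matrix_unit r r x \<in> S"
  proof (cases "\<exists>j. j \<noteq> r")
    case True
    then obtain j where j: "j \<noteq> r" by blast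
    then obtain v where v: "v \<in> {quat_i, quat_j}" "A $ r $ j * v * A $ j $ r \<notin> \<real>"
      using nonreal_sandwich[OF off[of r j] off[of j r]] by auto
    have "matrix_unit r r (A $ r $ j * v * A $ j $ r)
        = matrix_unit r j (A $ r $ j) ** matrix_unit j j v ** matrix_unit j r (A $ j $ r)"
      by (simp add: matrix_unit_mult)
    with v show ?thesis
      using j by (intro that[OF v]) (simp add: R.subalgebraD R.matrix_unit_entry_mem)
  next
    case False
    have "A $ p $ q = mat (A $ r $ r) $ p $ q" for p q
    proof -
      have "p = r" "q = r" using False by auto
      then show ?thesis by (simp add: mat_def)
    qed
    then have "A = mat (A $ r $ r)"
      unfolding vec_eq_iff by blast
    with nonscalar have "A $ r $ r \<notin> \<real>"
      by (metis Reals_cases)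
    then show ?thesis
      by (intro that[of quat_i "A $ r $ r"]) (simp_all add: R.matrix_unit_entry_mem)
  qed
  obtain u where u: "u \<in> {quat_i, quat_j}" "u * x \<noteq> x * u"
    using noncommuting_unit[OF x] by blast
  \<comment> \<open>The unit at \<open>r\<close> is chosen after \<open>x\<close>, so as not to
    commute with it.\<close>
  define w where "w k = (if k = r then u else v)" for k
  have w_sq: "w k * w k = - 1" for k
    using u v by (auto simp: w_def quat_eq_iff quat_defs)
  define d where "d k = s k *\<^sub>R w k" for k
  have "S = UNIV" if S: "real_matrix_subalgebra S" "A \<in> S" "diag_mat d \<in> S" for S
  proof -
    have RS: "R.subalgebra S"
      using S(1) by (simp add: subalgebra_Reals_iff)
    have sub: "subspace S"
      using S(1) by (simp add: real_matrix_subalgebra_def)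
    have sq: "d k * d k = - of_real (s k * s k)" for k
      by (simp add: d_def w_sq of_real_def)
    have "diag_mat (\<lambda>k. d k * d k) \<in> S"
      using R.subalgebraD(3)[OF RS S(3,3)] by (simp add: diag_mat_mult)
    moreover have "inj (\<lambda>k. d k * d k)"
    proof (rule injI)
      fix k l assume "d k * d k = d l * d l"
      then have "s k * s k = s l * s l"
        by (simp only: sq neg_equal_iff_equal of_real_eq_iff)
      then have "s k = s l"
        using s[of k] s[of l] by (simp add: square_eq_iff)
      then show "k = l" by (simp add: inj_s)
    qed
    moreover have "d k * d k \<in> \<real>" "d k * d k \<noteq> 0" for k
      using s[of k] by (simp_all only: sq Reals_minus_iff Reals_of_real) (simp flip: of_real_mult)
    ultimately have idem: "matrix_unit k k 1 \<in> S" for k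
      using R.diagonal_idempotent_mem[OF RS, of "\<lambda>k. d k * d k"] by blast
    have w_mem: "matrix_unit k k (w k) \<in> S" for k
    proof -
      have "matrix_unit k k (w k) = inverse (s k) *\<^sub>R (diag_mat d ** matrix_unit k k 1)"
        using s[of k] by (auto simp: vec_eq_iff mult_matrix_unit_nth matrix_unit_nth diag_mat_nth d_def)
      then show ?thesis
        using subspace_scale[OF sub R.subalgebraD(3)[OF RS S(3) idem]] by simp
    qed
    define K where "K = {q. matrix_unit r r q \<in> S}"
    have "matrix_unit r r (p + q) = matrix_unit r r p + matrix_unit r r q"
      "matrix_unit r r (c *\<^sub>R p) = c *\<^sub>R matrix_unit r r p" "matrix_unit r r (0 :: quat) = 0"
      for p q :: quat and c
      by (simp_all add: vec_eq_iff matrix_unit_nth)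
    then have "subspace K"
      using sub by (simp add: K_def subspace_def)
    moreover have "p * q \<in> K" if "p \<in> K" "q \<in> K" for p q
      using R.subalgebraD(3)[OF RS, of "matrix_unit r r p" "matrix_unit r r q"] that
      by (simp add: K_def matrix_unit_mult)
    moreover have "u \<in> K"
      using w_mem[of r] by (simp add: K_def w_def)
    moreover have "x \<in> K"
    proof -
      have "matrix_unit k k v \<in> S" if "k \<noteq> r" for k
        using w_mem[of k] that by (simp add: w_def)
      then show ?thesis
        using x_mem[OF RS S(2) idem] by (simp add: K_def)
    qed
    ultimately have "q \<in> K" for q
      using noncommuting_generate_quat[of K u x q] u by blast
    then show ?thesis
      by (intro R.subalgebra_eq_UNIV[OF RS S(2) off idem, of r]) (simp_all add: K_def)
  qed
  then show ?thesis using that by blast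
qed

theorem quat_generator:
  fixes A :: "quat^'n^'n"
  assumes "\<nexists>r. A = mat (of_real r)"
  shows "\<exists>B. diagonalisable B \<and> generated_real_algebra A B = UNIV"
proof -
  interpret R: central_subfield "\<real> :: quat set"
    by (rule central_subfield_Reals)
  obtain A' where "similar_matrix A A'" and A': "\<And>p q. p \<noteq> q \<Longrightarrow> A' $ p $ q \<noteq> 0" "\<nexists>r. A' = mat (of_real r)"
    using quat_similar_nonzero_off_diagonal[OF assms] by blast
  then obtain P Q where PQ: "P ** Q = mat 1" "Q ** P = mat 1" "A' = P ** A ** Q"
    by (auto simp: similar_matrix_def)
  obtain d where gen: "\<And>S. real_matrix_subalgebra S \<Longrightarrow> A' \<in> S \<Longrightarrow> diag_mat d \<in> S \<Longrightarrow> S = UNIV"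
    using quat_diagonal_generator[OF A'] by blast
  have "generated_real_algebra A (Q ** diag_mat d ** P) = UNIV"
  proof (rule R.conjugate_generates[OF PQ])
    show "S = UNIV" if "R.subalgebra S" "A' \<in> S" "diag_mat d \<in> S" for S
      using gen[OF _ that(2,3)] that(1) by (simp add: subalgebra_Reals_iff)
    show "R.subalgebra (generated_real_algebra A (Q ** diag_mat d ** P))"
      by (simp add: subalgebra_Reals_iff real_matrix_subalgebra_generated_real_algebra)
  qed (rule generators_mem_generated_real_algebra)+
  moreover have "diagonalisable (Q ** diag_mat d ** P)"
    by (rule diagonalisable_conjugate[OF PQ(1,2) diagonal_matrix_diag_mat])
  ultimately show ?thesis by blast
qed

text \<open>A nonzero vector \<open>v\<close> with \<open>v $ i \<noteq> 0\<close> is sent to any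
  \<open>w\<close> by the matrix whose only nonzero column is the \<open>i\<close>-th, with entries
  \<open>w $ p * inverse (v $ i)\<close>.\<close>

lemma irreducible_algebra_UNIV: "irreducible_algebra (UNIV :: (quat^'n^'n) set)"
  unfolding irreducible_algebra_def
proof (intro allI impI)
  fix V :: "(quat^'n) set"
  assume V: "right_subspace V \<and> (\<forall>X\<in>UNIV. \<forall>v\<in>V. X *v v \<in> V)"
  show "V = {0} \<or> V = UNIV"
  proof (cases "\<exists>v\<in>V. v \<noteq> 0")
    case True
    then obtain v i where v: "v \<in> V" "v $ i \<noteq> 0"
      by (auto simp: vec_eq_iff)
    have "w \<in> V" for w
    proof -
      have "(\<chi> p q. if q = i then w $ p * inverse (v $ i) else 0) *v v = w"
        using v(2) by (simp add: vec_eq_iff matrix_vector_mult_def mult.assoc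
          if_distrib[where f = "\<lambda>x. x * _"] cong: if_cong)
      then show ?thesis using V v(1) by (metis UNIV_I)
    qed
    then show ?thesis by blast
  next
    case False
    moreover have "0 \<in> V" using V by (simp add: right_subspace_def)
    ultimately show ?thesis by blast
  qed
qed

theorem corollary3p4:
  shows "(\<forall>A :: 'a::field^'n^'n.
      (infinite (UNIV :: 'a set) \<or> 2 * CARD('n) + 1 \<le> card (UNIV :: 'a set)) \<and>
      (\<nexists>c. A = mat c) \<longrightarrow>
      (\<exists>B. diagonalisable B \<and> generated_algebra A B = UNIV)) \<and>
    (\<forall>A :: quat^'m^'m.
      (\<nexists>r. A = mat (of_real r)) \<longrightarrow>
      (\<exists>B. diagonalisable B \<and>
        irreducible_algebra (generated_real_algebra A B) \<and>
        (\<exists>P :: quat^'m^'m. invertible P \<and>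
          (\<lambda>X. matrix_inv P ** X ** P) ` generated_real_algebra A B
            \<in> {matrices_over \<real>, matrices_over quat_Complexes, matrices_over UNIV})))"
proof (intro conjI allI impI)
  fix A :: "'a^'n^'n"
  assume "(infinite (UNIV :: 'a set) \<or> 2 * CARD('n) + 1 \<le> card (UNIV :: 'a set)) \<and> (\<nexists>c. A = mat c)"
  then show "\<exists>B. diagonalisable B \<and> generated_algebra A B = UNIV"
    using field_generator by blast
next
  fix A :: "quat^'m^'m"
  assume "\<nexists>r. A = mat (of_real r)"
  then obtain B where B: "diagonalisable B" "generated_real_algebra A B = UNIV"
    using quat_generator by blast
  \<comment> \<open>The generated algebra is already the full quaternionic matrix ring, so the
    identity similarity realises the third alternative.\<close>
  have "invertible (mat 1 :: quat^'m^'m)"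
    by (auto simp: invertible_def)
  moreover have "(\<lambda>X. matrix_inv (mat 1) ** X ** mat 1) ` generated_real_algebra A B = matrices_over UNIV"
    by (simp add: B(2) matrix_inv_unique matrices_over_def)
  ultimately show "\<exists>B. diagonalisable B \<and>
        irreducible_algebra (generated_real_algebra A B) \<and>
        (\<exists>P :: quat^'m^'m. invertible P \<and>
          (\<lambda>X. matrix_inv P ** X ** P) ` generated_real_algebra A B
            \<in> {matrices_over \<real>, matrices_over quat_Complexes, matrices_over UNIV})"
    using B irreducible_algebra_UNIV
    by (intro exI[of _ B] conjI exI[of _ "mat 1"]) simp_all
qed

end
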